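(* Let $G$ be a metabelian group and let $X$ be any finite generating set of $G$. Then the palindromic width $\mathrm{PW}(G,X)$ is finite.
   Context: A group is metabelian if its derived subgroup is abelian. For a group $G$ with generating set $X$, a palindromic word on $X \cup X^{-1}$ is a finite word with letters in $X\cup X^{-1}$ (not necessarily reduced) that reads the same forwards as backwards. The palindromic width $\mathrm{PW}(G,X)$ is the minimal $n$ such that every $g\in G$ can be expressed as a product of $n$ or fewer elements represented by palindromic words on $X\cup X^{-1}$ (and is infinite if no such $n$ exists). *)

theory Defs
  imports "HOL-Algebra.Generated_Groups" "HOL-Library.Extended_Nat"
begin

definition metabelian :: "('a, 'b) monoid_scheme \<Rightarrow> bool" where
  "metabelian G \<longleftrightarrow> group G \<and> comm_group (G\<lparr>carrier := derived G (carrier G)\<rparr>)"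

definition word_value :: "('a, 'b) monoid_scheme \<Rightarrow> 'a list \<Rightarrow> 'a" where
  "word_value G w = foldr (\<otimes>\<^bsub>G\<^esub>) w \<one>\<^bsub>G\<^esub>"

text \<open>Letters are group elements rather than formal symbols.  If distinct formal letters
  name the same element of \<^term>\<open>X \<union> set_inv\<^bsub>G\<^esub> X\<close>, then choosing one name for each
  element lifts a palindrome to a formal one with the same value, so both readings have
  the same palindromic elements.  Words need not be reduced and may be empty.\<close>

definition palindromic_words :: "('a, 'b) monoid_scheme \<Rightarrow> 'a set \<Rightarrow> 'a list set" where
  "palindromic_words G X = {w \<in> lists (X \<union> set_inv\<^bsub>G\<^esub> X). rev w = w}"

definition palindromic_elements :: "('a, 'b) monoid_scheme \<Rightarrow> 'a set \<Rightarrow> 'a set" where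
  "palindromic_elements G X = word_value G ` palindromic_words G X"

definition palindromic_width_le :: "('a, 'b) monoid_scheme \<Rightarrow> 'a set \<Rightarrow> nat \<Rightarrow> bool" where
  "palindromic_width_le G X n \<longleftrightarrow>
     (\<forall>g \<in> carrier G. \<exists>ps \<in> lists (palindromic_elements G X).
        length ps \<le> n \<and> g = word_value G ps)"

text \<open>The infimum of the empty set in \<^typ>\<open>enat\<close> is \<open>\<infinity>\<close>, and a nonempty set attains its infimum.\<close>

definition palindromic_width :: "('a, 'b) monoid_scheme \<Rightarrow> 'a set \<Rightarrow> enat" where
  "palindromic_width G X = (INF n \<in> {n. palindromic_width_le G X n}. enat n)"

end

theory Submission
  imports Defs
begin

text \<open>The commutator \<open>[g, x]\<close> of any \<open>g\<close> with a generator \<open>x\<close> is a product of three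
  palindromes: if the word \<open>w\<close> represents \<open>g\<close> and \<open>rev w\<close> represents \<open>h\<close>, then
  \<open>[g, x] = (g x h) (g h)\<^sup>-\<^sup>1 x\<^sup>-\<^sup>1\<close>.  Let \<open>D\<close> be the derived subgroup.  As \<open>D\<close> is abelian,
  each \<open>[D, x]\<close> is a normal subgroup; let \<open>N\<^sub>1\<close> be the product of these over the generators.
  Modulo \<open>N\<^sub>1\<close> the subgroup \<open>D\<close> is central, so \<open>[G, x]\<close> is a normal subgroup modulo \<open>N\<^sub>1\<close>; let
  \<open>N\<^sub>2\<close> be the product of \<open>N\<^sub>1\<close> and all these.  Modulo \<open>N\<^sub>2\<close> the group is abelian, hence
  the product of \<open>N\<^sub>2\<close> and the cyclic subgroups of the generators is \<open>G\<close>.  Every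
  element of \<open>G\<close> is thus a product of a bounded number of powers \<open>x\<^sup>a\<close> and commutators \<open>[g, x]\<close>.\<close>

section \<open>Sets of bounded length\<close>

text \<open>For \<open>P\<close> the palindromic elements and \<open>B\<close> the whole carrier
  this is finiteness of the width. Arbitrary \<open>B\<close> are allowed so that the bound can be
  carried up a chain of subgroups.\<close>

definition bounded_length :: "('a, 'b) monoid_scheme \<Rightarrow> 'a set \<Rightarrow> 'a set \<Rightarrow> bool" where
  "bounded_length G P B \<longleftrightarrow> (\<exists>n. \<forall>g\<in>B. \<exists>ps\<in>lists P. length ps \<le> n \<and> g = word_value G ps)"

lemma bounded_lengthI:
  assumes "\<And>g. g \<in> B \<Longrightarrow> \<exists>ps\<in>lists P. length ps \<le> n \<and> g = word_value G ps"
  shows "bounded_length G P B"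
  using assms unfolding bounded_length_def by blast

lemma bounded_length_subset:
  "bounded_length G P B \<Longrightarrow> A \<subseteq> B \<Longrightarrow> bounded_length G P A"
  unfolding bounded_length_def by (meson subsetD)

text \<open>After \<open>m_assoc\<close> has moved all brackets to the right, an element and its
  inverse meet in front of a remaining product. Cancelling there lets \<open>simp\<close> settle the
  commutator identities below.\<close>

lemma (in group) inv_cancel_left [simp]:
  assumes "x \<in> carrier G" "y \<in> carrier G"
  shows "inv x \<otimes> (x \<otimes> y) = y" "x \<otimes> (inv x \<otimes> y) = y"
  using assms by (simp_all add: m_assoc [symmetric])

section \<open>Values of concatenated, inverted and constant words\<close>

lemma (in monoid) word_value_closed [simp]:
  "set w \<subseteq> carrier G \<Longrightarrow> word_value G w \<in> carrier G"
  by (induction w) (auto simp: word_value_def)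

lemma (in monoid) word_value_append:
  "set u \<subseteq> carrier G \<Longrightarrow> set v \<subseteq> carrier G \<Longrightarrow>
    word_value G (u @ v) = word_value G u \<otimes> word_value G v"
proof (induction u)
  case Nil
  then show ?case using word_value_closed [of v] by (simp add: word_value_def)
next
  case (Cons a u)
  then show ?case
    using word_value_closed [of u] word_value_closed [of v] by (simp add: word_value_def m_assoc)
qed

lemma word_value_Nil [simp]: "word_value G [] = \<one>\<^bsub>G\<^esub>"
  by (simp add: word_value_def)

lemma word_value_Cons [simp]: "word_value G (a # w) = a \<otimes>\<^bsub>G\<^esub> word_value G w"
  by (simp add: word_value_def)

lemma (in group) word_value_rev_inv:
  "set w \<subseteq> carrier G \<Longrightarrow> word_value G (rev (map (m_inv G) w)) = inv (word_value G w)"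
proof (induction w)
  case Nil
  then show ?case by (simp add: word_value_def)
next
  case (Cons a w)
  then have "set (rev (map (m_inv G) w)) \<subseteq> carrier G" by auto
  with Cons show ?case
    using word_value_closed [of w] by (simp add: word_value_append inv_mult_group)
qed

lemma (in group) word_value_replicate:
  "x \<in> carrier G \<Longrightarrow> word_value G (replicate n x) = x [^] n"
proof (induction n)
  case (Suc n)
  then show ?case unfolding nat_pow_Suc2 [OF Suc.prems] by simp
qed simp

lemma (in group) bounded_length_set_mult:
  assumes "P \<subseteq> carrier G" "bounded_length G P A" "bounded_length G P B"
  shows "bounded_length G P (A <#> B)"
proof -
  obtain m n where m: "\<forall>g\<in>A. \<exists>ps\<in>lists P. length ps \<le> m \<and> g = word_value G ps"
    and n: "\<forall>g\<in>B. \<exists>ps\<in>lists P. length ps \<le> n \<and> g = word_value G ps"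
    using assms(2,3) unfolding bounded_length_def by (elim exE)
  show ?thesis
  proof (rule bounded_lengthI)
    fix g assume "g \<in> A <#> B"
    then obtain a b where ab: "a \<in> A" "b \<in> B" "g = a \<otimes> b" by (auto simp: set_mult_def)
    from bspec [OF m ab(1)] obtain u where u: "u \<in> lists P" "length u \<le> m" "a = word_value G u" by blast
    from bspec [OF n ab(2)] obtain v where v: "v \<in> lists P" "length v \<le> n" "b = word_value G v" by blast
    have "set u \<subseteq> carrier G" "set v \<subseteq> carrier G" using u(1) v(1) assms(1) by blast+
    then have "g = word_value G (u @ v)" using u(3) v(3) ab(3) by (simp add: word_value_append)
    with u v show "\<exists>ps\<in>lists P. length ps \<le> m + n \<and> g = word_value G ps"
      by (intro bexI [of _ "u @ v"]) auto
  qed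
qed

section \<open>Products with normal subgroups\<close>

text \<open>The hypotheses on \<open>S\<close> say that its image in G/N is a normal subgroup, and
  \<open>N <#> S\<close> is the preimage of that image. Working with cosets in this way avoids
  quotient groups.\<close>

lemma (in group) normal_set_multI:
  assumes N: "N \<lhd> G" and S: "S \<subseteq> carrier G" "S \<noteq> {}"
    and mult: "\<And>a b. a \<in> S \<Longrightarrow> b \<in> S \<Longrightarrow> a \<otimes> b \<in> N <#> S"
    and inverse: "\<And>a. a \<in> S \<Longrightarrow> inv a \<in> N <#> S"
    and conj: "\<And>g a. g \<in> carrier G \<Longrightarrow> a \<in> S \<Longrightarrow> g \<otimes> a \<otimes> inv g \<in> N <#> S"
  shows "N <#> S \<lhd> G"
proof -
  have sub: "subgroup N G" using N normal_imp_subgroup by blast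
  have NC: "N \<subseteq> carrier G" using sub subgroup.subset by blast
  have conjN: "g \<otimes> n \<otimes> inv g \<in> N" if "g \<in> carrier G" "n \<in> N" for g n
    using normal_invE(2) [OF N] that by blast
  have left: "n \<otimes> t \<in> N <#> S" if n: "n \<in> N" and t: "t \<in> N <#> S" for n t
  proof -
    obtain m s where ms: "m \<in> N" "s \<in> S" "t = m \<otimes> s" using t by (auto simp: set_mult_def)
    have "n \<in> carrier G" "m \<in> carrier G" "s \<in> carrier G" using n ms NC S(1) by auto
    then have "n \<otimes> t = (n \<otimes> m) \<otimes> s" using ms by (simp add: m_assoc)
    moreover have "n \<otimes> m \<in> N" by (rule subgroup.m_closed [OF sub n ms(1)])
    ultimately show ?thesis using ms by (auto simp: set_mult_def)
  qed
  have TC: "N <#> S \<subseteq> carrier G" using NC S(1) by (rule set_mult_closed)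
  have "subgroup (N <#> S) G"
  proof (rule subgroupI)
    show "N <#> S \<subseteq> carrier G" by (fact TC)
    show "N <#> S \<noteq> {}"
      using S(2) subgroup.one_closed [OF sub] by (auto simp: set_mult_def)
  next
    fix t assume "t \<in> N <#> S"
    then obtain n a where na: "n \<in> N" "a \<in> S" "t = n \<otimes> a" by (auto simp: set_mult_def)
    then have c: "n \<in> carrier G" "a \<in> carrier G" using NC S(1) by auto
    \<comment> \<open>The inverse of \<open>n \<otimes> a\<close> has its N-factor on the right.
      Conjugation by \<open>inv a\<close> brings it to the left, where \<open>left\<close> absorbs
      it.\<close>
    have "inv a \<otimes> inv n \<otimes> inv (inv a) \<in> N"
      using c by (intro conjN subgroup.m_inv_closed [OF sub na(1)]) auto
    moreover have "inv t = (inv a \<otimes> inv n \<otimes> inv (inv a)) \<otimes> inv a"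
      using c na by (simp add: inv_mult_group m_assoc)
    ultimately show "inv t \<in> N <#> S" using left inverse na by auto
  next
    fix t u assume "t \<in> N <#> S" "u \<in> N <#> S"
    then obtain n a m b where na: "n \<in> N" "a \<in> S" "t = n \<otimes> a" "m \<in> N" "b \<in> S" "u = m \<otimes> b"
      by (auto simp: set_mult_def)
    then have c: "n \<in> carrier G" "a \<in> carrier G" "m \<in> carrier G" "b \<in> carrier G"
      using NC S(1) by auto
    \<comment> \<open>Moving \<open>a\<close> past \<open>m\<close> replaces \<open>m\<close> by a
      conjugate, which is still in \<open>N\<close>.\<close>
    have "t \<otimes> u = n \<otimes> ((a \<otimes> m \<otimes> inv a) \<otimes> (a \<otimes> b))"
      using c na by (simp add: m_assoc)
    then show "t \<otimes> u \<in> N <#> S" using left conjN mult na c by auto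
  qed
  moreover have "g \<otimes> t \<otimes> inv g \<in> N <#> S" if g: "g \<in> carrier G" and t: "t \<in> N <#> S" for g t
  proof -
    obtain n a where na: "n \<in> N" "a \<in> S" "t = n \<otimes> a" using t by (auto simp: set_mult_def)
    then have c: "n \<in> carrier G" "a \<in> carrier G" using NC S(1) by auto
    have "g \<otimes> t \<otimes> inv g = (g \<otimes> n \<otimes> inv g) \<otimes> (g \<otimes> a \<otimes> inv g)"
      using c na g by (simp add: m_assoc)
    then show ?thesis using left conjN conj na g by auto
  qed
  ultimately show ?thesis by (rule normal_invI)
qed

lemma (in group) subset_set_mult:
  assumes "subgroup N G" "S \<subseteq> carrier G"
  shows "S \<subseteq> N <#> S"
proof
  fix s assume "s \<in> S"
  then have "s = \<one> \<otimes> s" using assms by auto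
  with \<open>s \<in> S\<close> show "s \<in> N <#> S"
    using subgroup.one_closed [OF assms(1)] unfolding set_mult_def by blast
qed

text \<open>This brings a set that is itself a normal subgroup into the form \<open>N <#> S\<close>
  that \<open>bounded_normal_join\<close> expects, with \<open>N\<close> trivial.\<close>

lemma (in group) one_set_mult:
  assumes "S \<subseteq> carrier G"
  shows "{\<one>} <#> S = S"
proof -
  have "{\<one>} <#> S = (\<lambda>s. \<one> \<otimes> s) ` S" unfolding set_mult_def by blast
  also have "\<dots> = id ` S" using assms by (intro image_cong) auto
  finally show ?thesis by simp
qed

lemma (in group) subset_set_mult_right:
  assumes "N \<subseteq> carrier G" "\<one> \<in> S"
  shows "N \<subseteq> N <#> S"
proof
  fix n assume "n \<in> N"
  then have "n = n \<otimes> \<one>" using assms by auto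
  with \<open>n \<in> N\<close> show "n \<in> N <#> S" using assms(2) unfolding set_mult_def by blast
qed

lemma (in group) normal_set_mult_normal:
  assumes "N \<lhd> G" "M \<lhd> G"
  shows "N <#> M \<lhd> G"
proof -
  have M: "subgroup M G" and N: "subgroup N G" using assms normal_imp_subgroup by auto
  have sub: "M \<subseteq> N <#> M" using subset_set_mult [OF N subgroup.subset [OF M]] .
  show ?thesis
  proof (rule normal_set_multI [OF assms(1)])
    show "M \<subseteq> carrier G" "M \<noteq> {}"
      using subgroup.subset [OF M] subgroup.one_closed [OF M] by auto
  next
    show "a \<otimes> b \<in> N <#> M" if "a \<in> M" "b \<in> M" for a b
      using subsetD [OF sub subgroup.m_closed [OF M that]] .
    show "inv a \<in> N <#> M" if "a \<in> M" for a
      using subsetD [OF sub subgroup.m_inv_closed [OF M that]] .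
    show "g \<otimes> a \<otimes> inv g \<in> N <#> M" if "g \<in> carrier G" "a \<in> M" for g a
      using subsetD [OF sub normal_invE(2) [OF assms(2) that]] .
  qed
qed

text \<open>A product of normal subgroups is normal and contains its factors, and the length bounds
  of the factors add up; finitely many factors keep the bound finite. Each \<open>S i\<close> need
  only be a normal subgroup modulo \<open>N\<close>, so the induction multiplies by
  \<open>N <#> S j\<close>.\<close>

lemma (in group) bounded_normal_join:
  assumes "finite I" and P: "P \<subseteq> carrier G"
    and N: "N \<lhd> G" "bounded_length G P N"
    and S: "\<And>i. i \<in> I \<Longrightarrow> S i \<subseteq> carrier G" "\<And>i. i \<in> I \<Longrightarrow> \<one> \<in> S i"
      "\<And>i. i \<in> I \<Longrightarrow> N <#> S i \<lhd> G" "\<And>i. i \<in> I \<Longrightarrow> bounded_length G P (S i)"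
  shows "\<exists>M. M \<lhd> G \<and> bounded_length G P M \<and> N \<subseteq> M \<and> (\<forall>i\<in>I. S i \<subseteq> M)"
  using assms(1) S
proof (induction I)
  case empty
  then show ?case using N by auto
next
  case (insert j I)
  then obtain M where M: "M \<lhd> G" "bounded_length G P M" "N \<subseteq> M" "\<forall>i\<in>I. S i \<subseteq> M" by auto
  let ?T = "N <#> S j"
  have T: "?T \<lhd> G" using insert.prems by auto
  note T_sub = normal_imp_subgroup [OF T] and M_sub = normal_imp_subgroup [OF M(1)]
  have "?T <#> M \<lhd> G" using normal_set_mult_normal [OF T M(1)] .
  moreover have "bounded_length G P (?T <#> M)"
    using bounded_length_set_mult P N(2) M(2) insert.prems(4) by auto
  moreover have "?T \<subseteq> ?T <#> M" using subset_set_mult_right [OF subgroup.subset [OF T_sub] subgroup.one_closed [OF M_sub]] .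
  moreover have "M \<subseteq> ?T <#> M"
    using subset_set_mult [OF T_sub subgroup.subset [OF M_sub]] .
  moreover have "S j \<subseteq> ?T"
    using subset_set_mult [OF normal_imp_subgroup [OF N(1)]] insert.prems(1) by auto
  ultimately show ?case using M by (intro exI [of _ "?T <#> M"]) blast
qed

section \<open>Commutators\<close>

text \<open>The convention agrees with that of the generators of \<open>derived\<close>, so
  membership in the derived subgroup is immediate.\<close>

definition (in group) commutator :: "'a \<Rightarrow> 'a \<Rightarrow> 'a" where
  "commutator g h = g \<otimes> h \<otimes> inv g \<otimes> inv h"

lemma (in group) commutator_closed [simp]:
  "g \<in> carrier G \<Longrightarrow> h \<in> carrier G \<Longrightarrow> commutator g h \<in> carrier G"
  by (simp add: commutator_def)

lemma (in group) commutator_one_left [simp]: "h \<in> carrier G \<Longrightarrow> commutator \<one> h = \<one>"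
  by (simp add: commutator_def)

lemma (in group) commutator_in_derived:
  "g \<in> carrier G \<Longrightarrow> h \<in> carrier G \<Longrightarrow> commutator g h \<in> derived G (carrier G)"
  unfolding derived_def commutator_def by (rule generate.incl) blast

text \<open>The set \<open>?C\<close> is the preimage of the centralizer of mN in G/N. It is
  therefore a subgroup, and it contains all of \<open>generate G X\<close> once it contains
  \<open>X\<close>.\<close>

lemma (in group) commutator_in_normal_generate:
  assumes N: "N \<lhd> G" and X: "X \<subseteq> carrier G" "g \<in> generate G X" and m: "m \<in> carrier G"
    and "\<And>x. x \<in> X \<Longrightarrow> commutator m x \<in> N"
  shows "commutator m g \<in> N"
proof -
  let ?C = "{g \<in> carrier G. commutator m g \<in> N}"
  have sub: "subgroup N G" using N normal_imp_subgroup by blast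
  have conjN: "g \<otimes> n \<otimes> inv g \<in> N" if "g \<in> carrier G" "n \<in> N" for g n
    using normal_invE(2) [OF N] that by blast
  have "subgroup ?C G"
  proof (rule subgroupI)
    show "?C \<subseteq> carrier G" by auto
    have "\<one> \<in> ?C" using m subgroup.one_closed [OF sub] by (simp add: commutator_def)
    then show "?C \<noteq> {}" by blast
  next
    fix a assume "a \<in> ?C"
    then have a: "a \<in> carrier G" "commutator m a \<in> N" by auto
    have "commutator m (inv a) = inv a \<otimes> inv (commutator m a) \<otimes> inv (inv a)"
      using a m by (simp add: commutator_def inv_mult_group m_assoc)
    moreover have "inv a \<otimes> inv (commutator m a) \<otimes> inv (inv a) \<in> N"
      using a by (intro conjN subgroup.m_inv_closed [OF sub] inv_closed)
    ultimately show "inv a \<in> ?C" using a by simp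
  next
    fix a b assume "a \<in> ?C" "b \<in> ?C"
    then have ab: "a \<in> carrier G" "b \<in> carrier G" "commutator m a \<in> N" "commutator m b \<in> N"
      by auto
    have "commutator m (a \<otimes> b) = commutator m a \<otimes> (a \<otimes> commutator m b \<otimes> inv a)"
      using ab m by (simp add: commutator_def inv_mult_group m_assoc)
    then show "a \<otimes> b \<in> ?C" using conjN subgroup.m_closed [OF sub] ab by auto
  qed
  moreover have "X \<subseteq> ?C" using assms by auto
  ultimately show ?thesis using generate_subgroup_incl X(2) by blast
qed

text \<open>Since \<open>D\<close> is abelian and contains all commutators, d -> [d, x] is a
  homomorphism from \<open>D\<close> to itself, so its image is a subgroup. The image is normal
  because conjugation by g takes [d, x] to [g d g^-1, x].\<close>

lemma (in group) normal_commutators_of_abelian: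
  assumes D: "D \<lhd> G" and derived: "derived G (carrier G) \<subseteq> D"
    and comm: "\<And>a b. a \<in> D \<Longrightarrow> b \<in> D \<Longrightarrow> a \<otimes> b = b \<otimes> a"
    and x: "x \<in> carrier G"
  shows "(\<lambda>d. commutator d x) ` D \<lhd> G"
proof -
  have sub: "subgroup D G" using D normal_imp_subgroup by blast
  have DC: "D \<subseteq> carrier G" using sub subgroup.subset by blast
  have cD: "commutator a b \<in> D" if "a \<in> carrier G" "b \<in> carrier G" for a b
    using that commutator_in_derived derived by blast
  have mult: "commutator a x \<otimes> commutator b x = commutator (a \<otimes> b) x"
    if ab: "a \<in> D" "b \<in> D" for a b
  proof -
    have c: "a \<in> carrier G" "b \<in> carrier G" using ab DC by auto
    \<comment> \<open>Here \<open>a\<close> is separated from its inverse by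
      \<open>commutator b x\<close>. Both lie in \<open>D\<close>, so they can be swapped.\<close>
    have "commutator (a \<otimes> b) x = (a \<otimes> commutator b x) \<otimes> (x \<otimes> inv a \<otimes> inv x)"
      using c x by (simp add: commutator_def inv_mult_group m_assoc)
    also have "a \<otimes> commutator b x = commutator b x \<otimes> a" using comm ab cD c x by blast
    also have "\<dots> \<otimes> (x \<otimes> inv a \<otimes> inv x) = commutator b x \<otimes> commutator a x"
      using c x by (simp add: commutator_def m_assoc)
    also have "\<dots> = commutator a x \<otimes> commutator b x" using comm cD c x by blast
    finally show ?thesis by simp
  qed
  have "subgroup ((\<lambda>d. commutator d x) ` D) G"
  proof (rule subgroupI)
    show "(\<lambda>d. commutator d x) ` D \<subseteq> carrier G" using DC x by auto
    show "(\<lambda>d. commutator d x) ` D \<noteq> {}" using subgroup.one_closed [OF sub] by auto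
  next
    fix t assume "t \<in> (\<lambda>d. commutator d x) ` D"
    then obtain d where d: "d \<in> D" "t = commutator d x" by auto
    then have i: "inv d \<in> D" using subgroup.m_inv_closed [OF sub] by blast
    have c: "d \<in> carrier G" "inv d \<in> carrier G" using d i DC by auto
    have "commutator (inv d) x \<otimes> t = \<one>" using mult [OF i d(1)] d c x by simp
    then have "inv t = commutator (inv d) x" using d c x by (intro inv_equality) auto
    then show "inv t \<in> (\<lambda>d. commutator d x) ` D" using i by blast
  next
    fix t u assume "t \<in> (\<lambda>d. commutator d x) ` D" "u \<in> (\<lambda>d. commutator d x) ` D"
    then show "t \<otimes> u \<in> (\<lambda>d. commutator d x) ` D"
      using mult subgroup.m_closed [OF sub] by auto
  qed
  moreover have "g \<otimes> t \<otimes> inv g \<in> (\<lambda>d. commutator d x) ` D"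
    if g: "g \<in> carrier G" and t: "t \<in> (\<lambda>d. commutator d x) ` D" for g t
  proof -
    obtain d where d: "d \<in> D" "t = commutator d x" using t by auto
    then have dC: "d \<in> carrier G" using DC by auto
    define e where "e = g \<otimes> d \<otimes> inv g"
    define c where "c = commutator g x"
    have eD: "e \<in> D" unfolding e_def using normal_invE(2) [OF D g d(1)] .
    then have e: "e \<in> carrier G" "inv e \<in> D"
      using DC subgroup.m_inv_closed [OF sub] by auto
    have c: "c \<in> D" "c \<in> carrier G" unfolding c_def using cD g x by auto
    have "x \<otimes> inv e \<otimes> inv x \<in> D" using normal_invE(2) [OF D x e(2)] .
    then have swap: "c \<otimes> (x \<otimes> inv e \<otimes> inv x) = (x \<otimes> inv e \<otimes> inv x) \<otimes> c"
      using comm c by blast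
    \<comment> \<open>Conjugation by \<open>g\<close> turns d into \<open>e\<close> and x into
      \<open>c \<otimes> x\<close>. The factor \<open>c\<close> lies in \<open>D\<close>, so it
      commutes with the conjugate of \<open>inv e\<close> and cancels against
      \<open>inv c\<close>.\<close>
    have "g \<otimes> t \<otimes> inv g = e \<otimes> (c \<otimes> (x \<otimes> inv e \<otimes> inv x)) \<otimes> inv c"
      unfolding e_def c_def using d dC g x
      by (simp add: commutator_def inv_mult_group m_assoc)
    also have "\<dots> = commutator e x"
      unfolding swap using e c x by (simp add: commutator_def m_assoc)
    finally show ?thesis using eD by auto
  qed
  ultimately show ?thesis by (rule normal_invI)
qed

text \<open>Modulo \<open>N\<close> every [h, x] is central, so g -> [g, x] becomes a homomorphism
  into the centre of G/N, and any subgroup of the centre is normal. The set of these commutators is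
  in general a subgroup only modulo \<open>N\<close>.\<close>

lemma (in group) normal_commutators_modulo_central:
  assumes N: "N \<lhd> G" and x: "x \<in> carrier G"
    and central: "\<And>g h. g \<in> carrier G \<Longrightarrow> h \<in> carrier G \<Longrightarrow> commutator g (commutator h x) \<in> N"
  shows "N <#> (\<lambda>g. commutator g x) ` carrier G \<lhd> G"
proof -
  let ?S = "(\<lambda>g. commutator g x) ` carrier G"
  have sub: "subgroup N G" using N normal_imp_subgroup by blast
  have NC: "N \<subseteq> carrier G" using sub subgroup.subset by blast
  \<comment> \<open>This is [gh, x] = g [h, x] g^-1 [g, x], with the conjugate rewritten as [g,
    [h, x]] [h, x].\<close>
  have mult: "commutator h x \<otimes> commutator g x
      = inv (commutator g (commutator h x)) \<otimes> commutator (g \<otimes> h) x"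
    if "g \<in> carrier G" "h \<in> carrier G" for g h
    using that x by (simp add: commutator_def inv_mult_group m_assoc)
  have inN: "n \<otimes> s \<in> N <#> ?S" if "n \<in> N" "s \<in> ?S" for n s
    using that unfolding set_mult_def by blast
  have invN: "inv (commutator g (commutator h x)) \<in> N"
    if "g \<in> carrier G" "h \<in> carrier G" for g h
    using that central subgroup.m_inv_closed [OF sub] by blast
  show ?thesis
  proof (rule normal_set_multI [OF N])
    show "?S \<subseteq> carrier G" "?S \<noteq> {}" using x by auto
  next
    fix s t assume "s \<in> ?S" "t \<in> ?S"
    then obtain g h where gh: "g \<in> carrier G" "h \<in> carrier G"
        "s = commutator h x" "t = commutator g x" by auto
    then show "s \<otimes> t \<in> N <#> ?S" unfolding gh(3,4) mult [OF gh(1,2)] by (intro inN invN) auto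
  next
    fix s assume "s \<in> ?S"
    then obtain g where g: "g \<in> carrier G" "s = commutator g x" by auto
    let ?n = "commutator g (commutator (inv g) x)"
    have n: "?n \<in> N" using central g by auto
    \<comment> \<open>In \<open>mult\<close> with h = g^-1 the factor [gh, x] is trivial; only the
      correction from \<open>N\<close> remains.\<close>
    have "commutator (inv g) x \<otimes> s = inv ?n" using mult [of g "inv g"] g x by simp
    then have "inv (commutator (inv g) x \<otimes> s) = ?n" using g x by simp
    then have "inv s \<otimes> inv (commutator (inv g) x) = ?n" using g x by (simp add: inv_mult_group)
    then have "inv s = ?n \<otimes> commutator (inv g) x"
      using g x inv_solve_right [of ?n "inv s" "commutator (inv g) x"] by auto
    then show "inv s \<in> N <#> ?S" using n g by (auto intro: inN)
  next
    fix g s assume g: "g \<in> carrier G" and "s \<in> ?S"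
    then obtain h where h: "h \<in> carrier G" "s = commutator h x" by auto
    have "g \<otimes> s \<otimes> inv g = commutator g s \<otimes> s"
      using g h x by (simp add: commutator_def [of g] m_assoc)
    then show "g \<otimes> s \<otimes> inv g \<in> N <#> ?S" using g h central by (auto intro: inN)
  qed
qed

text \<open>The powers of x already form a subgroup, and every subgroup is normal modulo
  \<open>N\<close> because G/N is abelian.\<close>

lemma (in group) normal_powers_of_abelian_quotient:
  assumes N: "N \<lhd> G" and x: "x \<in> carrier G"
    and abelian: "\<And>g s. g \<in> carrier G \<Longrightarrow> s \<in> carrier G \<Longrightarrow> commutator g s \<in> N"
  shows "N <#> range (\<lambda>k::int. x [^] k) \<lhd> G"
proof -
  let ?S = "range (\<lambda>k::int. x [^] k)"
  have SC: "?S \<subseteq> carrier G" using x by auto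
  have sub: "?S \<subseteq> N <#> ?S" using subset_set_mult [OF normal_imp_subgroup [OF N] SC] .
  show ?thesis
  proof (rule normal_set_multI [OF N SC])
    show "?S \<noteq> {}" by auto
  next
    fix s t assume "s \<in> ?S" "t \<in> ?S"
    then have "s \<otimes> t \<in> ?S" by (auto simp flip: int_pow_mult [OF x])
    then show "s \<otimes> t \<in> N <#> ?S" using sub by blast
  next
    fix s assume "s \<in> ?S"
    then have "inv s \<in> ?S" by (auto simp flip: int_pow_neg [OF x])
    then show "inv s \<in> N <#> ?S" using sub by blast
  next
    fix g s assume g: "g \<in> carrier G" and s: "s \<in> ?S"
    then have c: "s \<in> carrier G" using SC by blast
    then have "g \<otimes> s \<otimes> inv g = commutator g s \<otimes> s"
      using g by (simp add: commutator_def m_assoc)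
    then show "g \<otimes> s \<otimes> inv g \<in> N <#> ?S"
      using abelian [OF g c] s unfolding set_mult_def by blast
  qed
qed

section \<open>Palindromes\<close>

lemma (in group) letters_in_carrier:
  "X \<subseteq> carrier G \<Longrightarrow> X \<union> set_inv X \<subseteq> carrier G"
  by (auto simp: SET_INV_def)

lemma (in group) inv_letter:
  "X \<subseteq> carrier G \<Longrightarrow> a \<in> X \<union> set_inv X \<Longrightarrow> inv a \<in> X \<union> set_inv X"
  by (auto simp: SET_INV_def)

lemma (in group) palindromic_elements_in_carrier:
  assumes "X \<subseteq> carrier G"
  shows "palindromic_elements G X \<subseteq> carrier G"
proof
  fix p assume "p \<in> palindromic_elements G X"
  then obtain w where "w \<in> lists (X \<union> set_inv X)" "p = word_value G w"
    by (auto simp: palindromic_elements_def palindromic_words_def)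
  moreover from this have "set w \<subseteq> carrier G" using letters_in_carrier [OF assms] by blast
  ultimately show "p \<in> carrier G" by simp
qed

lemma palindromic_elementI:
  "w \<in> lists (X \<union> set_inv\<^bsub>G\<^esub> X) \<Longrightarrow> rev w = w \<Longrightarrow> word_value G w \<in> palindromic_elements G X"
  by (auto simp: palindromic_elements_def palindromic_words_def)

lemma (in group) generate_word:
  assumes "X \<subseteq> carrier G" "g \<in> generate G X"
  obtains w where "w \<in> lists (X \<union> set_inv X)" "g = word_value G w"
proof -
  have "\<exists>w \<in> lists (X \<union> set_inv X). g = word_value G w"
    using assms(2)
  proof (induction rule: generate.induct)
    case one
    then show ?case by (intro bexI [of _ "[]"]) (auto simp: word_value_def)
  next
    case (incl h)
    then show ?case using assms(1) by (intro bexI [of _ "[h]"]) (auto simp: word_value_def)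
  next
    case (inv h)
    then show ?case
      using assms(1) by (intro bexI [of _ "[inv h]"]) (auto simp: word_value_def SET_INV_def)
  next
    case (eng g h)
    then obtain u v where uv: "u \<in> lists (X \<union> set_inv X)" "g = word_value G u"
      "v \<in> lists (X \<union> set_inv X)" "h = word_value G v" by blast
    then have "set u \<subseteq> carrier G" "set v \<subseteq> carrier G"
      using letters_in_carrier [OF assms(1)] by blast+
    then have "g \<otimes> h = word_value G (u @ v)" using uv by (simp add: word_value_append)
    then show ?case using uv by (intro bexI [of _ "u @ v"]) auto
  qed
  then show thesis using that by blast
qed

lemma (in group) bounded_length_commutators:
  assumes X: "X \<subseteq> carrier G" "generate G X = carrier G" and x: "x \<in> X"
  shows "bounded_length G (palindromic_elements G X) ((\<lambda>g. commutator g x) ` carrier G)"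
proof (rule bounded_lengthI)
  let ?L = "X \<union> set_inv X"
  fix c assume "c \<in> (\<lambda>g. commutator g x) ` carrier G"
  then obtain g where g: "g \<in> carrier G" "c = commutator g x" by auto
  then obtain w where w: "w \<in> lists ?L" "g = word_value G w"
    using generate_word [OF X(1)] X(2) by blast
  let ?h = "word_value G (rev w)"
  have LC: "?L \<subseteq> carrier G" using letters_in_carrier [OF X(1)] .
  have wC: "set w \<subseteq> carrier G" using w LC by auto
  have xC: "x \<in> carrier G" using X(1) x by auto
  have hC: "?h \<in> carrier G" using wC by simp
  \<comment> \<open>Both \<open>?p\<close> and \<open>w @ rev w\<close> are palindromes, and
    reversing and inverting the letters of the latter gives a palindrome for the inverse of its
    value. However long \<open>w\<close> is, only three palindromes are used.\<close>
  let ?p = "w @ [x] @ rev w" and ?q = "rev (map (m_inv G) (w @ rev w))"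
  have p: "word_value G ?p = g \<otimes> (x \<otimes> ?h)"
    using wC xC w by (simp add: word_value_append)
  have q: "word_value G ?q = inv (g \<otimes> ?h)"
    using wC w by (simp only: word_value_rev_inv word_value_append set_append set_rev Un_least)
  have r: "word_value G [inv x] = inv x" using xC by simp
  have "word_value G ?p \<in> palindromic_elements G X"
    using w x by (intro palindromic_elementI) auto
  moreover have "word_value G ?q \<in> palindromic_elements G X"
  proof (rule palindromic_elementI)
    have "\<forall>a\<in>set w. inv a \<in> ?L" using w inv_letter [OF X(1)] by blast
    then show "?q \<in> lists ?L" by auto
  qed (simp add: rev_map)
  moreover have "word_value G [inv x] \<in> palindromic_elements G X"
    using x inv_letter [OF X(1)] by (intro palindromic_elementI) auto
  moreover have "c = word_value G [word_value G ?p, word_value G ?q, word_value G [inv x]]"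
    unfolding p q r using g xC hC
    by (simp add: commutator_def inv_mult_group m_assoc)
  ultimately show "\<exists>ps\<in>lists (palindromic_elements G X). length ps \<le> 3 \<and> c = word_value G ps"
    by (intro bexI [of _ "[word_value G ?p, word_value G ?q, word_value G [inv x]]"]) auto
qed

text \<open>A constant word is a palindrome, so a single palindrome suffices for every exponent;
  negative exponents use the letter \<open>inv x\<close>.\<close>

lemma (in group) bounded_length_powers:
  assumes X: "X \<subseteq> carrier G" and x: "x \<in> X"
  shows "bounded_length G (palindromic_elements G X) (range (\<lambda>k::int. x [^] k))"
proof (rule bounded_lengthI)
  fix s assume "s \<in> range (\<lambda>k::int. x [^] k)"
  then obtain k :: int where k: "s = x [^] k" by auto
  have xC: "x \<in> carrier G" using X x by auto
  have pal: "a [^] n \<in> palindromic_elements G X" if a: "a \<in> X \<union> set_inv X" for a and n :: nat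
  proof -
    have "word_value G (replicate n a) \<in> palindromic_elements G X"
      using a by (intro palindromic_elementI) auto
    then show ?thesis using word_value_replicate letters_in_carrier [OF X] a by auto
  qed
  have s: "s \<in> palindromic_elements G X"
  proof (cases "0 \<le> k")
    case True
    then have "s = x [^] nat k" unfolding k int_pow_def2 by simp
    then show ?thesis using pal [of x "nat k"] x by simp
  next
    case False
    then have "s = inv x [^] nat (- k)"
      unfolding k int_pow_def2 using xC by (simp add: nat_pow_inv del: pow_nat)
    then show ?thesis using pal [OF inv_letter [OF X], of x "nat (- k)"] x by simp
  qed
  have "s = word_value G [s]" using k xC by simp
  then show "\<exists>ps\<in>lists (palindromic_elements G X). length ps \<le> 1 \<and> s = word_value G ps"
    using s by (intro bexI [of _ "[s]"]) auto
qed

section \<open>A chain of normal subgroups of bounded length that reaches the whole group\<close>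

lemma (in group) metabelian_bounded_length:
  assumes comm: "\<And>a b. a \<in> derived G (carrier G) \<Longrightarrow> b \<in> derived G (carrier G) \<Longrightarrow> a \<otimes> b = b \<otimes> a"
    and X: "finite X" "X \<subseteq> carrier G" "generate G X = carrier G"
  shows "bounded_length G (palindromic_elements G X) (carrier G)"
proof -
  let ?P = "palindromic_elements G X" and ?D = "derived G (carrier G)"
  have P: "?P \<subseteq> carrier G" using palindromic_elements_in_carrier X(2) by blast
  have D: "?D \<lhd> G" using derived_self_is_normal .
  have DC: "?D \<subseteq> carrier G" using normal_imp_subgroup [OF D] subgroup.subset by blast
  have D1: "\<one> \<in> ?D" using normal_imp_subgroup [OF D] subgroup.one_closed by blast
  have xC: "x \<in> carrier G" if "x \<in> X" for x using that X(2) by blast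
  note commutators_bounded = bounded_length_commutators [OF X(2,3)]
  have reach: "commutator m g \<in> N"
    if "N \<lhd> G" "m \<in> carrier G" "g \<in> carrier G" "\<And>x. x \<in> X \<Longrightarrow> commutator m x \<in> N" for N m g
    using commutator_in_normal_generate [OF that(1) X(2)] that X(3) by blast

  have "\<exists>N. N \<lhd> G \<and> bounded_length G ?P N \<and> {\<one>} \<subseteq> N \<and>
      (\<forall>x\<in>X. (\<lambda>d. commutator d x) ` ?D \<subseteq> N)"
  proof (rule bounded_normal_join [OF X(1) P one_is_normal])
    \<comment> \<open>The empty product has value \<open>\<one>\<close>, so length 0
      suffices.\<close>
    show "bounded_length G ?P {\<one>}"
      by (rule bounded_lengthI [of _ _ 0]) auto
  next
    fix x assume x: "x \<in> X"
    show sub: "(\<lambda>d. commutator d x) ` ?D \<subseteq> carrier G" using DC xC [OF x] by auto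
    show "\<one> \<in> (\<lambda>d. commutator d x) ` ?D"
      using D1 xC [OF x] by (intro image_eqI [of _ _ \<one>]) auto
    show "{\<one>} <#> (\<lambda>d. commutator d x) ` ?D \<lhd> G"
      unfolding one_set_mult [OF sub]
      by (intro normal_commutators_of_abelian D subset_refl comm xC [OF x])
    \<comment> \<open>These are some of the commutators [g, x] with g in G, so the bound for those
      applies.\<close>
    show "bounded_length G ?P ((\<lambda>d. commutator d x) ` ?D)"
      using bounded_length_subset [OF commutators_bounded [OF x] image_mono [OF DC]] .
  qed
  then obtain N1 where N1: "N1 \<lhd> G" "bounded_length G ?P N1"
    and DN1: "\<forall>x\<in>X. (\<lambda>d. commutator d x) ` ?D \<subseteq> N1" by blast

  \<comment> \<open>By construction d commutes with each generator modulo \<open>N1\<close>, and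
    \<open>reach\<close> extends this to all of G. Inverting then exchanges the two arguments, as
    needed for \<open>normal_commutators_modulo_central\<close>.\<close>
  have "commutator d g \<in> N1" if "d \<in> ?D" "g \<in> carrier G" for d g
    using reach [OF N1(1) subsetD [OF DC that(1)] that(2)] DN1 that(1) by blast
  moreover have "commutator g d = inv (commutator d g)" if "d \<in> ?D" "g \<in> carrier G" for d g
    using subsetD [OF DC that(1)] that(2) by (simp add: commutator_def inv_mult_group m_assoc)
  ultimately have central: "commutator g d \<in> N1" if "d \<in> ?D" "g \<in> carrier G" for d g
    using that subgroup.m_inv_closed [OF normal_imp_subgroup [OF N1(1)]] by simp

  have "\<exists>N. N \<lhd> G \<and> bounded_length G ?P N \<and> N1 \<subseteq> N \<and>
      (\<forall>x\<in>X. (\<lambda>g. commutator g x) ` carrier G \<subseteq> N)"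
  proof (rule bounded_normal_join [OF X(1) P N1])
    fix x assume x: "x \<in> X"
    show "(\<lambda>g. commutator g x) ` carrier G \<subseteq> carrier G" using xC [OF x] by auto
    show "\<one> \<in> (\<lambda>g. commutator g x) ` carrier G"
      using xC [OF x] by (intro image_eqI [of _ _ \<one>]) auto
    show "N1 <#> (\<lambda>g. commutator g x) ` carrier G \<lhd> G"
      \<comment> \<open>The inner commutator [h, x] lies in \<open>?D\<close>, so
        \<open>central\<close> applies to it.\<close>
      by (intro normal_commutators_modulo_central N1(1) xC [OF x] central commutator_in_derived)
    show "bounded_length G ?P ((\<lambda>g. commutator g x) ` carrier G)"
      by (rule commutators_bounded [OF x])
  qed
  then obtain N2 where N2: "N2 \<lhd> G" "bounded_length G ?P N2"
    and GN2: "\<forall>x\<in>X. (\<lambda>g. commutator g x) ` carrier G \<subseteq> N2" by blast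

  \<comment> \<open>\<open>N2\<close> contains [g, x] for every g and every generator x, so the
    generators are central modulo \<open>N2\<close>; by \<open>reach\<close> the whole quotient is
    abelian.\<close>
  have abelian: "commutator g h \<in> N2" if "g \<in> carrier G" "h \<in> carrier G" for g h
    using reach [OF N2(1) that] GN2 that by blast
  have "\<exists>N. N \<lhd> G \<and> bounded_length G ?P N \<and> N2 \<subseteq> N \<and>
      (\<forall>x\<in>X. range (\<lambda>k::int. x [^] k) \<subseteq> N)"
  proof (rule bounded_normal_join [OF X(1) P N2])
    fix x assume x: "x \<in> X"
    show "range (\<lambda>k::int. x [^] k) \<subseteq> carrier G" using xC [OF x] by auto
    show "\<one> \<in> range (\<lambda>k::int. x [^] k)" by (rule range_eqI [of _ _ 0]) simp
    show "N2 <#> range (\<lambda>k::int. x [^] k) \<lhd> G"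
      by (intro normal_powers_of_abelian_quotient N2(1) xC [OF x] abelian)
    show "bounded_length G ?P (range (\<lambda>k::int. x [^] k))"
      by (rule bounded_length_powers [OF X(2) x])
  qed
  then obtain N3 where N3: "N3 \<lhd> G" "bounded_length G ?P N3"
    and XN3: "\<forall>x\<in>X. range (\<lambda>k::int. x [^] k) \<subseteq> N3" by blast

  \<comment> \<open>Exponent 1 puts each generator into the subgroup \<open>N3\<close>, which must
    then be all of G.\<close>
  have "X \<subseteq> N3"
  proof
    fix x assume x: "x \<in> X"
    have "x = x [^] (1::int)" using xC [OF x] by (simp add: int_pow_1)
    then show "x \<in> N3" using XN3 x by blast
  qed
  then have "carrier G \<subseteq> N3"
    using generate_subgroup_incl [OF _ normal_imp_subgroup [OF N3(1)]] X(3) by auto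
  then show ?thesis using bounded_length_subset N3(2) by blast
qed

theorem theorem1p3:
  fixes G :: "('a, 'b) monoid_scheme" and X :: "'a set"
  assumes "metabelian G"
    and "finite X" and "X \<subseteq> carrier G" and "generate G X = carrier G"
  shows "palindromic_width G X < \<infinity>"
proof -
  interpret group G using assms(1) by (simp add: metabelian_def)
  interpret D: comm_group "G\<lparr>carrier := derived G (carrier G)\<rparr>"
    using assms(1) by (simp add: metabelian_def)
  have "bounded_length G (palindromic_elements G X) (carrier G)"
    using metabelian_bounded_length assms(2-4) D.m_comm by auto
  then obtain n where "palindromic_width_le G X n"
    unfolding bounded_length_def palindromic_width_le_def by blast
  \<comment> \<open>Any single bound \<open>n\<close> is a member of the set whose infimum is the
    width, so the infimum is at most \<open>enat n\<close>.\<close>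
  then have "palindromic_width G X \<le> enat n"
    unfolding palindromic_width_def by (intro INF_lower) simp
  also have "\<dots> < \<infinity>" by simp
  finally show ?thesis .
qed

end
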